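(* Let $A\in\mathbb{C}^{N\times N}$, $\mathbf b,\mathbf x_0\in\mathbb{C}^N$, $\mathbf r_0=\mathbf b-A\mathbf x_0\ne\mathbf 0$, $m\ge1$, and let $V_{m+1}\in\mathbb{C}^{N\times(m+1)}$ have linearly independent columns with first column $\mathbf r_0/\|\mathbf r_0\|$, such that for each $j\le m+1$ the first $j$ columns $V_j$ form a basis of $\mathcal K_j(A,\mathbf r_0)$ and $AV_m=V_{m+1}\underline{H_m}$ with $\underline{H_m}\in\mathbb{C}^{(m+1)\times m}$ upper Hessenberg. Let $S\in\mathbb{C}^{s\times N}$ be such that $SV_{m+1}$ has full column rank, with economy QR decomposition $SV_{m+1}=\widehat W_{m+1}R_{m+1}$ ($\widehat W_{m+1}$ with orthonormal columns, $R_{m+1}$ upper triangular with positive diagonal), and set $\underline{\widehat H_m}=R_{m+1}\underline{H_m}$, so that $SAV_m=\widehat W_{m+1}\underline{\widehat H_m}$. Let $\underline{\widehat Q_m}=(\hat q_{ij})\in\mathbb{C}^{(m+1)\times(m+1)}$ be the product of the $m$ Givens rotations which progressively reduces $\underline{\widehat H_m}$ to upper triangular form $\underline{\widehat Q_m}\,\underline{\widehat H_m}=\underline{\widehat R_m}$, and let $\hat s_m$ be the $m$-th Givens sine. Let $\widetilde{\mathbf r}_j$ denote the residual of the $j$-th sketched GMRES iterate ($\widetilde{\mathbf r}_0=\mathbf r_0$). Then $$\sin\theta\left(S\mathbf r_0,\,SA\mathcal K_m(A,\mathbf r_0)\right)=|\hat q_{m+1,1}|,\qquad \sin\theta\left(S\widetilde{\mathbf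 r}_{m-1},\,SA\mathcal K_m(A,\mathbf r_0)\right)=\hat s_m,$$ and the sketched residual norm satisfies $\|S\widetilde{\mathbf r}_m\|=|\hat s_m|\,\|S\widetilde{\mathbf r}_{m-1}\|$.
   Context: $\mathcal{K}_j(A,\mathbf r_0)=\mathrm{span}\{\mathbf r_0,\ldots,A^{j-1}\mathbf r_0\}$. $\|\cdot\|$ is the Euclidean norm. The $j$-th sketched GMRES iterate is $\widetilde{\mathbf x}_j=\mathbf x_0+V_j\widetilde{\mathbf y}_j$ where $\widetilde{\mathbf y}_j$ minimizes $\|S(\mathbf r_0-AV_j\mathbf y)\|$ over $\mathbf y\in\mathbb{C}^j$ (with $\widetilde{\mathbf x}_0=\mathbf x_0$), and $\widetilde{\mathbf r}_j=\mathbf b-A\widetilde{\mathbf x}_j$. For a nonzero vector $\mathbf v$ and subspace $\mathcal W$ with orthogonal projector $P_{\mathcal W}$, $\theta(\mathbf v,\mathcal W)\in[0,\pi/2]$ is defined by $\sin\theta(\mathbf v,\mathcal W)=\|(I-P_{\mathcal W})\mathbf v\|/\|\mathbf v\|$. Givens rotations: $\underline{\widehat Q_m}=G_m\cdots G_1$, where $G_j$ is the $(m+1)\times(m+1)$ identity except for the $2\times2$ block in rows and columns $j,j+1$, which equals $\begin{bmatrix}\hat c_j&\hat s_je^{\mathrm i\varphi_j}\\-\hat s_je^{-\mathrm i\varphi_j}&\hat c_j\end{bmatrix}$ with $\hat c_j,\hat s_j\ge0$, $\hat c_j^2+\hat s_j^2=1$, $\varphi_j\in\mathbb{R}$, chosen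 so that the $(j+1,j)$ entry of $G_j\cdots G_1\underline{\widehat H_m}$ is zero. The number $\hat s_j$ is the $j$-th Givens sine and $\hat c_j$ the $j$-th Givens cosine. *)

theory Defs
  imports
    Complex_Main
    "Jordan_Normal_Form.DL_Rank"
    "Jordan_Normal_Form.Schur_Decomposition"
begin

text \<open>
  Indices are 0-based throughout, as in Jordan_Normal_Form: row or column \<open>k\<close> of a matrix
  in mathematical notation is row or column \<open>k - 1\<close> here, and likewise for the Givens
  rotations.
\<close>

section \<open>Euclidean norm, orthogonal projection and angles\<close>

definition euclid_norm :: "complex vec \<Rightarrow> real" where
  "euclid_norm v = sqrt (\<Sum>i<dim_vec v. (cmod (v $ i))\<^sup>2)"

definition orth_proj :: "complex vec set \<Rightarrow> complex vec \<Rightarrow> complex vec" where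
  "orth_proj W v = (THE w. w \<in> W \<and> (\<forall>u\<in>W. (v - w) \<bullet>c u = 0))"

definition angle_to_subspace :: "complex vec \<Rightarrow> complex vec set \<Rightarrow> real" where
  "angle_to_subspace v W =
     (THE t. 0 \<le> t \<and> t \<le> pi / 2 \<and> sin t = euclid_norm (v - orth_proj W v) / euclid_norm v)"

section \<open>Spans and bases of columns\<close>

abbreviation cspan :: "nat \<Rightarrow> complex vec set \<Rightarrow> complex vec set" where
  "cspan n \<equiv> LinearCombinations.module.span class_ring (module_vec TYPE(complex) n)"

text \<open>Distinctness is needed because independence of the \<^emph>\<open>set\<close> of columns does not
  see repeated columns.\<close>

definition lin_indep_cols :: "complex mat \<Rightarrow> bool" where
  "lin_indep_cols M \<longleftrightarrow> distinct (cols M) \<and>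
     \<not> LinearCombinations.module.lin_dep class_ring (module_vec TYPE(complex) (dim_row M))
         (set (cols M))"

definition cols_basis_of :: "complex mat \<Rightarrow> complex vec set \<Rightarrow> bool" where
  "cols_basis_of M W \<longleftrightarrow> lin_indep_cols M \<and> cspan (dim_row M) (set (cols M)) = W"

definition first_cols :: "complex mat \<Rightarrow> nat \<Rightarrow> complex mat" where
  "first_cols M j = mat_of_cols (dim_row M) (take j (cols M))"

definition krylov :: "complex mat \<Rightarrow> complex vec \<Rightarrow> nat \<Rightarrow> complex vec set" where
  "krylov A r j = cspan (dim_vec r) ((\<lambda>i. (A ^\<^sub>m i) *\<^sub>v r) ` {..<j})"

definition upper_hessenberg :: "complex mat \<Rightarrow> bool" where
  "upper_hessenberg H \<longleftrightarrow> (\<forall>i<dim_row H. \<forall>j<dim_col H. Suc j < i \<longrightarrow> H $$ (i, j) = 0)"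

definition economy_qr :: "complex mat \<Rightarrow> complex mat \<Rightarrow> complex mat \<Rightarrow> bool" where
  "economy_qr M W R \<longleftrightarrow>
     W \<in> carrier_mat (dim_row M) (dim_col M) \<and>
     R \<in> carrier_mat (dim_col M) (dim_col M) \<and>
     M = W * R \<and>
     mat_adjoint W * W = 1\<^sub>m (dim_col M) \<and>
     upper_triangular R \<and>
     (\<forall>i<dim_col M. R $$ (i, i) \<in> \<real> \<and> 0 < Re (R $$ (i, i)))"

section \<open>Sketched GMRES\<close>

text \<open>For \<open>j = 0\<close> the only vector \<open>y\<close> is the empty one, so the iterate is \<open>x0\<close>.\<close>

definition sketched_gmres_iterate ::
  "complex mat \<Rightarrow> complex mat \<Rightarrow> complex vec \<Rightarrow> complex vec \<Rightarrow> complex mat \<Rightarrow>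
   nat \<Rightarrow> complex vec \<Rightarrow> bool" where
  "sketched_gmres_iterate S A b x0 V j x \<longleftrightarrow>
     (\<exists>y. is_arg_min
            (\<lambda>y. euclid_norm (S *\<^sub>v ((b - A *\<^sub>v x0) - A *\<^sub>v (first_cols V j *\<^sub>v y))))
            (\<lambda>y. y \<in> carrier_vec j) y
        \<and> x = x0 + first_cols V j *\<^sub>v y)"

section \<open>Givens rotations\<close>

definition givens_rotation :: "nat \<Rightarrow> nat \<Rightarrow> real \<Rightarrow> real \<Rightarrow> real \<Rightarrow> complex mat" where
  "givens_rotation n j c s \<phi> = mat n n (\<lambda>(k, l).
     if k = j \<and> l = j then of_real c
     else if k = j \<and> l = Suc j then of_real s * cis \<phi>
     else if k = Suc j \<and> l = j then - of_real s * cis (- \<phi>)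
     else if k = Suc j \<and> l = Suc j then of_real c
     else if k = l then 1 else 0)"

text \<open>The product of the first \<open>j\<close> rotations, the most recent one leftmost.\<close>

fun givens_product ::
  "nat \<Rightarrow> (nat \<Rightarrow> real) \<Rightarrow> (nat \<Rightarrow> real) \<Rightarrow> (nat \<Rightarrow> real) \<Rightarrow> nat \<Rightarrow> complex mat" where
  "givens_product n c s \<phi> 0 = 1\<^sub>m n"
| "givens_product n c s \<phi> (Suc j) =
     givens_rotation n j (c j) (s j) (\<phi> j) * givens_product n c s \<phi> j"

text \<open>The sines \<open>s\<close>, cosines \<open>c\<close> and phases \<open>\<phi>\<close> describe Givens rotations that successively
  annihilate the subdiagonal entries of the \<open>(m+1) \<times> m\<close> matrix \<open>H\<close>.\<close>

definition givens_reduction ::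
  "complex mat \<Rightarrow> nat \<Rightarrow> (nat \<Rightarrow> real) \<Rightarrow> (nat \<Rightarrow> real) \<Rightarrow> (nat \<Rightarrow> real) \<Rightarrow> bool" where
  "givens_reduction H m c s \<phi> \<longleftrightarrow>
     (\<forall>j<m. 0 \<le> c j \<and> 0 \<le> s j \<and> (c j)\<^sup>2 + (s j)\<^sup>2 = 1 \<and>
        (givens_product (Suc m) c s \<phi> (Suc j) * H) $$ (Suc j, j) = 0)"

end

theory Submission
  imports Defs
begin

text \<open>
  With \<open>U = W Q\<^sup>*\<close>, an isometry, the sketched data take the triangular form
  \<open>S r\<^sub>0 = U g\<close> and \<open>S A V\<^sub>m y = U (Rhat y)\<close>, where \<open>g\<close> is a nonzero multiple of the first column
  of \<open>Q\<close>. Since the Arnoldi matrix is unreduced, \<open>Rhat\<close> has full rank and so maps the vectors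
  supported on the first \<open>j\<close> coordinates onto the vectors of the same kind. Hence every angle and
  every least-squares residual amounts to deleting leading coordinates: \<open>S A K\<^sub>m\<close> is the image under
  \<open>U\<close> of the vectors with last coordinate zero, and \<open>S r\<^sub>j\<close> is the image of \<open>g\<close> with its first \<open>j\<close>
  coordinates deleted. The last rotation produces the final two coordinates of \<open>g\<close> from a single
  number \<open>t\<close>, with moduli \<open>c |t|\<close> and \<open>s |t|\<close>, which gives the sine. Moreover \<open>t \<noteq> 0\<close>, because the
  first unit vector is not in the range of an unreduced Hessenberg matrix.
\<close>

section \<open>Euclidean norm, orthogonal projection and angles\<close>

lemma euclid_norm_nonneg: "0 \<le> euclid_norm v"
  by (simp add: euclid_norm_def sum_nonneg)

lemma euclid_norm_square: "(euclid_norm v)\<^sup>2 = (\<Sum>i<dim_vec v. (cmod (v $ i))\<^sup>2)"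
  by (simp add: euclid_norm_def sum_nonneg)

lemma cscalar_prod_self: "v \<bullet>c v = complex_of_real ((euclid_norm v)\<^sup>2)"
  unfolding euclid_norm_square scalar_prod_def
  by (simp only: of_real_sum complex_norm_square) (simp add: atLeast0LessThan)

lemma euclid_norm_eq_0_iff: "v \<in> carrier_vec n \<Longrightarrow> euclid_norm v = 0 \<longleftrightarrow> v = 0\<^sub>v n"
  using cscalar_prod_self[of v] conjugate_square_eq_0_vec[of v n] by simp

text \<open>Closure under subtraction puts the difference of two candidates into \<open>W\<close>.
  That difference is then orthogonal to itself, hence zero, which settles the definite
  description.\<close>

lemma orth_proj_eqI:
  assumes "W \<subseteq> carrier_vec n" and diff: "\<And>u w. u \<in> W \<Longrightarrow> w \<in> W \<Longrightarrow> u - w \<in> W"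
    and v: "v \<in> carrier_vec n" and w: "w \<in> W" and orth: "\<And>u. u \<in> W \<Longrightarrow> (v - w) \<bullet>c u = 0"
  shows "orth_proj W v = w"
  unfolding orth_proj_def
proof (rule the_equality)
  fix w' assume w': "w' \<in> W \<and> (\<forall>u\<in>W. (v - w') \<bullet>c u = 0)"
  have wn: "w \<in> carrier_vec n" "w' \<in> carrier_vec n"
    using assms(1) w w' by auto
  have mem: "w' - w \<in> W"
    using diff w w' by blast
  have "w' - w = (v - w) - (v - w')"
    using v wn by (intro eq_vecI) auto
  moreover have "((v - w) - (v - w')) \<bullet>c (w' - w) = (v - w) \<bullet>c (w' - w) - (v - w') \<bullet>c (w' - w)"
    using v wn by (intro minus_scalar_prod_distrib[of _ n]) auto
  ultimately have "(w' - w) \<bullet>c (w' - w) = 0"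
    using orth[OF mem] w' mem by simp
  then have "w' - w = 0\<^sub>v n"
    using conjugate_square_eq_0_vec[of "w' - w" n] wn by auto
  then have *: "(w' - w) $ i = 0" if "i < n" for i
    using that by simp
  show "w' = w"
    using wn * by (intro eq_vecI) auto
qed (use w orth in auto)

text \<open>Sine is injective on \<open>[0, pi / 2]\<close>, so the described angle is
  \<open>arcsin \<rho>\<close>.\<close>

lemma sin_angle_to_subspace:
  assumes "euclid_norm (v - orth_proj W v) / euclid_norm v = \<rho>" "0 \<le> \<rho>" "\<rho> \<le> 1"
  shows "sin (angle_to_subspace v W) = \<rho>"
proof -
  have "angle_to_subspace v W = arcsin \<rho>"
    unfolding angle_to_subspace_def assms(1)
  proof (rule the_equality)
    show "0 \<le> arcsin \<rho> \<and> arcsin \<rho> \<le> pi / 2 \<and> sin (arcsin \<rho>) = \<rho>"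
      using assms(2,3) arcsin_bounded[of \<rho>] arcsin_le_mono[of 0 \<rho>] by auto
  qed (auto simp: arcsin_sin)
  then show ?thesis
    using assms(2,3) by simp
qed

section \<open>Isometric matrices\<close>

text \<open>Rectangular matrices with orthonormal columns, encoded by inner products so that
  products and inverses can be treated without computing adjoints.\<close>

definition isometric_mat :: "complex mat \<Rightarrow> bool" where
  "isometric_mat U \<longleftrightarrow>
     (\<forall>y\<in>carrier_vec (dim_col U). \<forall>z\<in>carrier_vec (dim_col U). (U *\<^sub>v y) \<bullet>c (U *\<^sub>v z) = y \<bullet>c z)"

lemma isometric_matD:
  "isometric_mat U \<Longrightarrow> U \<in> carrier_mat d n \<Longrightarrow> y \<in> carrier_vec n \<Longrightarrow> z \<in> carrier_vec n \<Longrightarrow>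
    (U *\<^sub>v y) \<bullet>c (U *\<^sub>v z) = y \<bullet>c z"
  by (auto simp: isometric_mat_def)

lemma euclid_norm_isometric:
  assumes "isometric_mat U" "U \<in> carrier_mat d n" "z \<in> carrier_vec n"
  shows "euclid_norm (U *\<^sub>v z) = euclid_norm z"
proof -
  have "complex_of_real ((euclid_norm (U *\<^sub>v z))\<^sup>2) = complex_of_real ((euclid_norm z)\<^sup>2)"
    using isometric_matD[OF assms assms(3)] unfolding cscalar_prod_self .
  then show ?thesis
    using euclid_norm_nonneg by (simp only: of_real_eq_iff power2_eq_iff_nonneg)
qed

lemma isometric_mat_inj:
  assumes "isometric_mat U" "U \<in> carrier_mat d n" "y \<in> carrier_vec n" "U *\<^sub>v y = 0\<^sub>v d"
  shows "y = 0\<^sub>v n"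
  using euclid_norm_isometric[OF assms(1-3)] assms(4) euclid_norm_eq_0_iff[of "0\<^sub>v d" d]
    euclid_norm_eq_0_iff[OF assms(3)] by simp

lemma isometric_mat_times:
  assumes "isometric_mat B" "isometric_mat C" "B \<in> carrier_mat d n" "C \<in> carrier_mat n k"
  shows "isometric_mat (B * C)"
  using assms by (auto simp: isometric_mat_def assoc_mult_mat_vec[OF assms(3,4)])

lemma cscalar_prod_mult_mat_vec:
  fixes U :: "complex mat"
  assumes U: "U \<in> carrier_mat d n" and x: "x \<in> carrier_vec d" and z: "z \<in> carrier_vec n"
  shows "x \<bullet>c (U *\<^sub>v z) = (mat_adjoint U *\<^sub>v x) \<bullet>c z"
proof -
  have "(\<Sum>i<d. x $ i * cnj (\<Sum>l<n. U $$ (i, l) * z $ l)) =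
      (\<Sum>i<d. \<Sum>l<n. x $ i * cnj (U $$ (i, l)) * cnj (z $ l))"
    by (simp add: sum_distrib_left mult.assoc)
  also have "\<dots> = (\<Sum>l<n. (\<Sum>i<d. cnj (U $$ (i, l)) * x $ i) * cnj (z $ l))"
    by (subst sum.swap) (simp add: sum_distrib_left sum_distrib_right ac_simps)
  finally show ?thesis
    using U x z by (simp add: scalar_prod_def mat_adjoint_def atLeast0LessThan cols_def)
qed

text \<open>Converts the orthonormality clause of \<open>economy_qr\<close> into the inner-product
  form.\<close>

lemma isometric_mat_adjointI:
  assumes U: "U \<in> carrier_mat d n" and adj: "mat_adjoint U * U = 1\<^sub>m n"
  shows "isometric_mat U"
  unfolding isometric_mat_def
proof (intro ballI)
  fix y z :: "complex vec" assume "y \<in> carrier_vec (dim_col U)" "z \<in> carrier_vec (dim_col U)"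
  then have yz: "y \<in> carrier_vec n" "z \<in> carrier_vec n"
    using U by auto
  have A: "mat_adjoint U \<in> carrier_mat n d"
    using U by (auto simp: mat_adjoint_def)
  have "mat_adjoint U *\<^sub>v (U *\<^sub>v y) = y"
    using assoc_mult_mat_vec[OF A U yz(1)] adj yz by simp
  then show "(U *\<^sub>v y) \<bullet>c (U *\<^sub>v z) = y \<bullet>c z"
    using cscalar_prod_mult_mat_vec[OF U mult_mat_vec_carrier[OF U yz(1)] yz(2)] by simp
qed

text \<open>A square isometry has trivial kernel, so its determinant is nonzero. The inverse
  inherits the isometry property because every vector is \<open>Q\<close> applied to its image under
  \<open>Q'\<close>.\<close>

lemma isometric_mat_inverse:
  assumes "isometric_mat Q" "Q \<in> carrier_mat n n"
  obtains Q' where "Q' \<in> carrier_mat n n" "Q' * Q = 1\<^sub>m n" "isometric_mat Q'"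
proof -
  have "det Q \<noteq> 0"
  proof
    assume "det Q = 0"
    then obtain v where v: "v \<in> carrier_vec n" "v \<noteq> 0\<^sub>v n" "Q *\<^sub>v v = 0\<^sub>v n"
      using det_0_iff_vec_prod_zero_field[OF assms(2)] by auto
    then show False
      using isometric_mat_inj[OF assms v(1)] by simp
  qed
  then obtain Q' where Q': "Q' \<in> carrier_mat n n" "Q' * Q = 1\<^sub>m n" "Q * Q' = 1\<^sub>m n"
    using det_non_zero_imp_unit[OF assms(2)] by (auto simp: Units_def ring_mat_def)
  have *: "Q *\<^sub>v (Q' *\<^sub>v y) = y" if "y \<in> carrier_vec n" for y
    using assoc_mult_mat_vec[OF assms(2) Q'(1) that] Q'(3) that by simp
  have "isometric_mat Q'"
    unfolding isometric_mat_def
  proof (intro ballI)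
    fix y z :: "complex vec" assume "y \<in> carrier_vec (dim_col Q')" "z \<in> carrier_vec (dim_col Q')"
    then have yz: "y \<in> carrier_vec n" "z \<in> carrier_vec n"
      using Q'(1) by auto
    show "(Q' *\<^sub>v y) \<bullet>c (Q' *\<^sub>v z) = y \<bullet>c z"
      using isometric_matD[OF assms, of "Q' *\<^sub>v y" "Q' *\<^sub>v z"] Q'(1) yz by (simp add: *)
  qed
  with Q'(1,2) show ?thesis
    by (rule that)
qed

section \<open>Coordinate subspaces and the deletion of leading coordinates\<close>

definition leading :: "nat \<Rightarrow> nat \<Rightarrow> complex vec set" where
  "leading k n = {z \<in> carrier_vec n. \<forall>i<n. k \<le> i \<longrightarrow> z $ i = 0}"

text \<open>The dimension is kept, so on vectors of length \<open>n\<close> this is the orthogonal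
  projector onto the complement of \<open>leading k n\<close>.\<close>

definition tail_vec :: "nat \<Rightarrow> complex vec \<Rightarrow> complex vec" where
  "tail_vec k z = vec (dim_vec z) (\<lambda>i. if i < k then 0 else z $ i)"

lemma tail_vec_carrier [simp]: "z \<in> carrier_vec n \<Longrightarrow> tail_vec k z \<in> carrier_vec n"
  by (intro carrier_vecI) (simp add: tail_vec_def carrier_vecD)

lemma dim_tail_vec [simp]: "dim_vec (tail_vec k z) = dim_vec z"
  by (simp add: tail_vec_def)

lemma index_tail_vec [simp]:
  "i < dim_vec z \<Longrightarrow> tail_vec k z $ i = (if i < k then 0 else z $ i)"
  by (simp add: tail_vec_def)

lemma tail_vec_tail_vec: "j \<le> k \<Longrightarrow> tail_vec k (tail_vec j z) = tail_vec k z"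
  by (intro eq_vecI) auto

lemma tail_vec_eq_0_iff:
  "z \<in> carrier_vec n \<Longrightarrow> tail_vec k z = 0\<^sub>v n \<longleftrightarrow> z \<in> leading k n"
  by (auto simp: leading_def vec_eq_iff)

lemma minus_tail_vec_leading: "z \<in> carrier_vec n \<Longrightarrow> z - tail_vec k z \<in> leading k n"
  by (auto simp: leading_def)

lemma minus_minus_tail_vec: "z - (z - tail_vec k z) = tail_vec k z"
  by (intro eq_vecI) auto

lemma euclid_norm_tail_vec_le: "euclid_norm (tail_vec k z) \<le> euclid_norm z"
  unfolding euclid_norm_def by (auto intro!: sum_mono)

lemma euclid_norm_tail_vec_Suc: "z \<in> carrier_vec (Suc n) \<Longrightarrow> euclid_norm (tail_vec n z) = cmod (z $ n)"
  by (simp add: euclid_norm_def)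

text \<open>An isometry preserves the orthogonal splitting of \<open>z\<close> into its first
  \<open>k\<close> coordinates and its tail. The projection of \<open>U z\<close> is therefore the
  image of the first part, and the distance to the subspace is the norm of the tail.\<close>

lemma sin_angle_leading_image:
  assumes U: "isometric_mat U" "U \<in> carrier_mat d n" and z: "z \<in> carrier_vec n"
  shows "sin (angle_to_subspace (U *\<^sub>v z) ((*\<^sub>v) U ` leading k n)) =
    euclid_norm (tail_vec k z) / euclid_norm z"
proof (rule sin_angle_to_subspace)
  have lead: "y \<in> carrier_vec n" if "y \<in> leading k n" for y
    using that by (simp add: leading_def)
  have diff: "U *\<^sub>v z - U *\<^sub>v (z - tail_vec k z) = U *\<^sub>v tail_vec k z"
    using U(2) z minus_minus_tail_vec[of z k]
    by (subst mult_minus_distrib_mat_vec[symmetric]) auto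
  have "orth_proj ((*\<^sub>v) U ` leading k n) (U *\<^sub>v z) = U *\<^sub>v (z - tail_vec k z)"
  proof (rule orth_proj_eqI)
    show "(*\<^sub>v) U ` leading k n \<subseteq> carrier_vec d"
      using U lead by auto
    show "u - w \<in> (*\<^sub>v) U ` leading k n"
      if uw: "u \<in> (*\<^sub>v) U ` leading k n" "w \<in> (*\<^sub>v) U ` leading k n" for u w
    proof -
      obtain y y' where y: "u = U *\<^sub>v y" "y \<in> leading k n" "w = U *\<^sub>v y'" "y' \<in> leading k n"
        using uw by blast
      have "y - y' \<in> leading k n"
        using y(2,4) by (auto simp: leading_def)
      moreover have "u - w = U *\<^sub>v (y - y')"
        using y U(2) by (subst mult_minus_distrib_mat_vec) (auto simp: lead)
      ultimately show ?thesis
        by blast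
    qed
    show "(U *\<^sub>v z - U *\<^sub>v (z - tail_vec k z)) \<bullet>c u = 0" if u: "u \<in> (*\<^sub>v) U ` leading k n" for u
    proof -
      obtain y where y: "u = U *\<^sub>v y" "y \<in> leading k n"
        using u by blast
      have "(U *\<^sub>v tail_vec k z) \<bullet>c u = tail_vec k z \<bullet>c y"
        using y lead z by (auto intro!: isometric_matD[OF U])
      also have "\<dots> = 0"
        using y(2) z by (auto simp: scalar_prod_def leading_def intro!: sum.neutral)
      finally show ?thesis
        unfolding diff .
    qed
  qed (use U z minus_tail_vec_leading in auto)
  then show "euclid_norm (U *\<^sub>v z - orth_proj ((*\<^sub>v) U ` leading k n) (U *\<^sub>v z)) /
      euclid_norm (U *\<^sub>v z) = euclid_norm (tail_vec k z) / euclid_norm z"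
    using euclid_norm_isometric[OF U z] euclid_norm_isometric[OF U, of "tail_vec k z"] z diff by simp
  show "euclid_norm (tail_vec k z) / euclid_norm z \<le> 1"
    using euclid_norm_tail_vec_le[of k z] euclid_norm_nonneg[of z]
    \<comment> \<open>For \<open>z = 0\<close> the quotient is 0 by the convention
      \<open>x / 0 = 0\<close>.\<close>
    by (cases "euclid_norm z = 0") (auto simp: field_simps)
qed (simp add: euclid_norm_nonneg)

text \<open>No admissible \<open>f y\<close> can change the coordinates of \<open>g\<close> from
  \<open>k\<close> on, while the first \<open>k\<close> can be cancelled completely. Only the range
  of \<open>f\<close> enters, so the residual is the same for every minimizer.\<close>

lemma least_squares_residual:
  assumes U: "isometric_mat U" "U \<in> carrier_mat d n" and g: "g \<in> carrier_vec n"
    and f: "f ` {y. P y} = leading k n"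
    and min: "is_arg_min (\<lambda>y. euclid_norm (U *\<^sub>v (g - f y))) P y"
  shows "g - f y = tail_vec k g"
proof -
  have lead: "f y' \<in> leading k n" if "P y'" for y'
    using f that by blast
  have Py: "P y" and le: "\<And>y'. P y' \<Longrightarrow> euclid_norm (U *\<^sub>v (g - f y)) \<le> euclid_norm (U *\<^sub>v (g - f y'))"
    using min by (auto simp: is_arg_min_def not_less)
  have fy: "f y \<in> carrier_vec n" and tail: "\<And>i. i < n \<Longrightarrow> k \<le> i \<Longrightarrow> f y $ i = 0"
    using lead[OF Py] by (auto simp: leading_def)
  \<comment> \<open>The competitor that matches the first \<open>k\<close> coordinates of
    \<open>g\<close> exactly.\<close>
  obtain y' where y': "P y'" "f y' = g - tail_vec k g"
    using f minus_tail_vec_leading[OF g] by (metis imageE mem_Collect_eq)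
  have "euclid_norm (g - f y) \<le> euclid_norm (tail_vec k g)"
    using le[OF y'(1)] g fy y'(2)
    by (simp add: minus_minus_tail_vec euclid_norm_isometric[OF U])
  then have sq: "(\<Sum>i<n. (cmod ((g - f y) $ i))\<^sup>2) \<le> (\<Sum>i<n. (cmod (tail_vec k g $ i))\<^sup>2)"
    using g fy by (simp add: euclid_norm_def)
  have comp: "(cmod (tail_vec k g $ i))\<^sup>2 \<le> (cmod ((g - f y) $ i))\<^sup>2" if "i < n" for i
    using that g fy tail[of i] by auto
  show ?thesis
  proof (intro eq_vecI)
    fix i assume "i < dim_vec (tail_vec k g)"
    then have i: "i < n"
      using g by simp
    \<comment> \<open>Each summand dominates its counterpart by \<open>comp\<close>, yet the total
      is no larger by \<open>sq\<close>; so the summands agree one by one.\<close>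
    have "(cmod ((g - f y) $ i))\<^sup>2 = (cmod (tail_vec k g $ i))\<^sup>2"
      using sum_mono_inv[of "\<lambda>i. (cmod (tail_vec k g $ i))\<^sup>2" "{..<n}" "\<lambda>i. (cmod ((g - f y) $ i))\<^sup>2" i]
        sq comp i sum_mono[of "{..<n}" "\<lambda>i. (cmod (tail_vec k g $ i))\<^sup>2" "\<lambda>i. (cmod ((g - f y) $ i))\<^sup>2"]
      by auto
    then show "(g - f y) $ i = tail_vec k g $ i"
      using i g fy tail[of i] by (cases "i < k") auto
  qed (use g fy in auto)
qed

section \<open>Triangular and unreduced Hessenberg matrices\<close>

text \<open>Triangularity gives one inclusion. The other is back substitution, by induction on
  \<open>k\<close>, in which injectivity rules out a zero pivot.\<close>

lemma triangular_image_leading: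
  fixes T :: "complex mat"
  assumes T: "T \<in> carrier_mat n p" and tri: "upper_triangular T" and "p \<le> n"
    and inj: "\<And>y. y \<in> carrier_vec p \<Longrightarrow> T *\<^sub>v y = 0\<^sub>v n \<Longrightarrow> y = 0\<^sub>v p"
    and "k \<le> p"
  shows "(*\<^sub>v) T ` leading k p = leading k n"
proof
  have Tz: "T $$ (i, j) = 0" if "j < i" "i < n" for i j
    using upper_triangularD[OF tri that(1)] that(2) T by simp
  show "(*\<^sub>v) T ` leading k p \<subseteq> leading k n"
  proof safe
    fix y assume y: "y \<in> leading k p"
    have "(T *\<^sub>v y) $ i = 0" if "i < n" "k \<le> i" for i
      using that y T Tz by (auto simp: leading_def scalar_prod_def intro!: sum.neutral)
    then show "T *\<^sub>v y \<in> leading k n"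
      using T y by (auto simp: leading_def)
  qed
  have "\<exists>y\<in>leading k p. T *\<^sub>v y = z" if "z \<in> leading k n" for z
    using \<open>k \<le> p\<close> that
  proof (induction k arbitrary: z)
    case 0
    then have "z = 0\<^sub>v n"
      by (auto simp: leading_def)
    then show ?case
      using T by (intro bexI[of _ "0\<^sub>v p"]) (auto simp: leading_def)
  next
    case (Suc k)
    have k: "k < p" "k < n"
      using Suc.prems \<open>p \<le> n\<close> by auto
    have u: "unit_vec p k \<in> leading (Suc k) p" "unit_vec p k \<in> carrier_vec p"
      by (auto simp: leading_def)
    have Tu: "T *\<^sub>v unit_vec p k = col T k"
      using T k by (intro eq_vecI) auto
    have colk: "col T k \<in> carrier_vec n"
      using T by auto
    \<comment> \<open>With a zero pivot, column \<open>k\<close> would have only its first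
      \<open>k\<close> entries, and by induction it would already be a combination of the earlier
      columns, against injectivity.\<close>
    have diag: "T $$ (k, k) \<noteq> 0"
    proof
      assume "T $$ (k, k) = 0"
      then have "col T k \<in> leading k n"
        using T k Tz by (auto simp: leading_def) (metis le_neq_implies_less)
      then obtain y where y: "y \<in> leading k p" "T *\<^sub>v y = col T k"
        using Suc.IH k by auto
      have yc: "y \<in> carrier_vec p"
        using y by (simp add: leading_def)
      have "T *\<^sub>v (unit_vec p k - y) = 0\<^sub>v n"
        using T yc y(2) colk by (simp add: mult_minus_distrib_mat_vec[OF T u(2) yc] Tu)
      then have "unit_vec p k - y = 0\<^sub>v p"
        using inj yc by simp
      then have "(unit_vec p k - y) $ k = 0"
        using k by simp
      then show False
        using y k yc by (simp add: leading_def)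
    qed
    \<comment> \<open>One step of back substitution: \<open>a\<close> is chosen to clear coordinate
      \<open>k\<close> of \<open>z\<close>.\<close>
    define a where "a = z $ k / T $$ (k, k)"
    have z: "z \<in> carrier_vec n"
      using Suc.prems by (simp add: leading_def)
    have "z - a \<cdot>\<^sub>v col T k \<in> leading k n"
      unfolding leading_def
    proof (intro CollectI conjI allI impI)
      fix i assume i: "i < n" "k \<le> i"
      show "(z - a \<cdot>\<^sub>v col T k) $ i = 0"
        using i T k diag z Suc.prems Tz[of k i]
        by (cases "i = k") (auto simp: a_def leading_def)
    qed (use z colk in auto)
    then obtain y where y: "y \<in> leading k p" "T *\<^sub>v y = z - a \<cdot>\<^sub>v col T k"
      using Suc.IH k by auto
    have yc: "y \<in> carrier_vec p"
      using y by (simp add: leading_def)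
    have "T *\<^sub>v (y + a \<cdot>\<^sub>v unit_vec p k) = z"
      using T yc y(2) z colk
      by (simp add: mult_add_distrib_mat_vec[OF T] mult_mat_vec[OF T] Tu)
        (auto intro!: eq_vecI)
    moreover have "y + a \<cdot>\<^sub>v unit_vec p k \<in> leading (Suc k) p"
      using y k by (auto simp: leading_def)
    ultimately show ?case
      by blast
  qed
  then show "leading k n \<subseteq> (*\<^sub>v) T ` leading k p"
    by blast
qed

lemma triangular_mat_inj:
  fixes R :: "complex mat"
  assumes R: "R \<in> carrier_mat n n" "upper_triangular R" and diag: "\<And>i. i < n \<Longrightarrow> R $$ (i, i) \<noteq> 0"
    and y: "y \<in> carrier_vec n" "R *\<^sub>v y = 0\<^sub>v n"
  shows "y = 0\<^sub>v n"
proof -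
  have "0 \<notin> set (diag_mat R)"
    using diag R(1) by (auto simp: diag_mat_def)
  then have "det R \<noteq> 0"
    using det_upper_triangular[OF R(2,1)] by (simp add: prod_list_zero_iff)
  then show ?thesis
    using det_0_iff_vec_prod_zero_field[OF R(1)] y by blast
qed

text \<open>If \<open>k\<close> is the last nonzero coordinate of \<open>y\<close>, a single term
  survives in row \<open>k + 1\<close> of the product: the subdiagonal entry times
  \<open>y $ k\<close>. That row is never row 0, which matters for the first unit vector.\<close>

lemma hessenberg_mult_vec_nonzero:
  fixes H :: "complex mat"
  assumes H: "H \<in> carrier_mat (Suc m) m" "upper_hessenberg H"
    and sub: "\<And>k. k < m \<Longrightarrow> H $$ (Suc k, k) \<noteq> 0"
    and y: "y \<in> carrier_vec m" "y \<noteq> 0\<^sub>v m"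
  obtains i where "1 \<le> i" "i \<le> m" "(H *\<^sub>v y) $ i \<noteq> 0"
proof -
  have "\<exists>k<m. y $ k \<noteq> 0"
    using y by (metis carrier_vecD eq_vecI index_zero_vec)
  then have ne: "{k. k < m \<and> y $ k \<noteq> 0} \<noteq> {}"
    by auto
  define k where "k = Max {k. k < m \<and> y $ k \<noteq> 0}"
  have k: "k < m" "y $ k \<noteq> 0"
    using Max_in[OF _ ne] by (auto simp: k_def)
  have above: "y $ l = 0" if "k < l" "l < m" for l
  proof (rule ccontr)
    assume "y $ l \<noteq> 0"
    then have "l \<le> k"
      unfolding k_def using that by (intro Max_ge) auto
    then show False
      using that by simp
  qed
  have "(H *\<^sub>v y) $ Suc k = (\<Sum>l<m. H $$ (Suc k, l) * y $ l)"
    using H(1) y(1) k by (simp add: scalar_prod_def atLeast0LessThan)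
  also have "\<dots> = (\<Sum>l\<in>{k}. H $$ (Suc k, l) * y $ l)"
  proof (rule sum.mono_neutral_right)
    show "\<forall>l\<in>{..<m} - {k}. H $$ (Suc k, l) * y $ l = 0"
    proof
      fix l assume "l \<in> {..<m} - {k}"
      \<comment> \<open>Columns left of \<open>k\<close> vanish in this row by the Hessenberg shape,
        those right of \<open>k\<close> by maximality of \<open>k\<close>.\<close>
      then consider "l < k" "l < m" | "k < l" "l < m"
        by fastforce
      then show "H $$ (Suc k, l) * y $ l = 0"
        using H above k by cases (auto simp: upper_hessenberg_def)
    qed
  qed (use k in auto)
  finally have "(H *\<^sub>v y) $ Suc k \<noteq> 0"
    using sub k by simp
  then show thesis
    using that[of "Suc k"] k by simp
qed

text \<open>The scalar \<open>a\<close> may be zero, so this covers both the injectivity of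
  \<open>H\<close> and the absence of the first unit vector from its range.\<close>

lemma hessenberg_mult_vec_eq_unit:
  fixes H :: "complex mat"
  assumes H: "H \<in> carrier_mat (Suc m) m" "upper_hessenberg H"
    and sub: "\<And>k. k < m \<Longrightarrow> H $$ (Suc k, k) \<noteq> 0"
    and y: "y \<in> carrier_vec m" "H *\<^sub>v y = a \<cdot>\<^sub>v unit_vec (Suc m) 0"
  shows "y = 0\<^sub>v m"
proof (rule ccontr)
  assume "y \<noteq> 0\<^sub>v m"
  then obtain i where "1 \<le> i" "i \<le> m" "(H *\<^sub>v y) $ i \<noteq> 0"
    using hessenberg_mult_vec_nonzero[OF H sub y(1)] by blast
  then show False
    unfolding y(2) by simp
qed

text \<open>Both factors are injective, \<open>Q\<close> as an isometry and \<open>H\<close> because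
  it is unreduced, so the triangular case applies to the product.\<close>

lemma hessenberg_triangular_image:
  fixes Q H :: "complex mat"
  assumes Q: "isometric_mat Q" "Q \<in> carrier_mat (Suc m) (Suc m)"
    and H: "H \<in> carrier_mat (Suc m) m" "upper_hessenberg H"
    and sub: "\<And>k. k < m \<Longrightarrow> H $$ (Suc k, k) \<noteq> 0"
    and tri: "upper_triangular (Q * H)" and "k \<le> m"
  shows "(*\<^sub>v) (Q * H) ` leading k m = leading k (Suc m)"
proof (rule triangular_image_leading)
  fix y :: "complex vec"
  assume y: "y \<in> carrier_vec m" "(Q * H) *\<^sub>v y = 0\<^sub>v (Suc m)"
  have "Q *\<^sub>v (H *\<^sub>v y) = 0\<^sub>v (Suc m)"
    using assoc_mult_mat_vec[OF Q(2) H(1) y(1)] y(2) by simp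
  then have "H *\<^sub>v y = 0\<^sub>v (Suc m)"
    using isometric_mat_inj[OF Q] H(1) y(1) by simp
  also have "0\<^sub>v (Suc m) = (0 :: complex) \<cdot>\<^sub>v unit_vec (Suc m) 0"
    by (intro eq_vecI) auto
  finally show "y = 0\<^sub>v m"
    using hessenberg_mult_vec_eq_unit[OF H sub y(1)] by blast
qed (use assms in auto)

text \<open>Otherwise the rotated vector would lie in the range of \<open>Q * H\<close>. Cancelling
  \<open>Q\<close> would give \<open>H y = a e\<close> with \<open>e\<close> the first unit vector,
  which forces \<open>y = 0\<close> and then \<open>a = 0\<close>.\<close>

lemma hessenberg_tail_nonzero:
  fixes Q H :: "complex mat"
  assumes Q: "isometric_mat Q" "Q \<in> carrier_mat (Suc m) (Suc m)"
    and H: "H \<in> carrier_mat (Suc m) m" "upper_hessenberg H"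
    and sub: "\<And>k. k < m \<Longrightarrow> H $$ (Suc k, k) \<noteq> 0"
    and tri: "upper_triangular (Q * H)" and a: "a \<noteq> 0"
  shows "tail_vec m (Q *\<^sub>v (a \<cdot>\<^sub>v unit_vec (Suc m) 0)) \<noteq> 0\<^sub>v (Suc m)"
proof
  define e where "e = a \<cdot>\<^sub>v unit_vec (Suc m) 0"
  have e: "e \<in> carrier_vec (Suc m)" "Q *\<^sub>v e \<in> carrier_vec (Suc m)"
    using Q(2) by (auto simp: e_def)
  assume "tail_vec m (Q *\<^sub>v (a \<cdot>\<^sub>v unit_vec (Suc m) 0)) = 0\<^sub>v (Suc m)"
  then have "Q *\<^sub>v e \<in> (*\<^sub>v) (Q * H) ` leading m m"
    using tail_vec_eq_0_iff[OF e(2), of m] hessenberg_triangular_image[OF Q H sub tri order_refl]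
    by (simp add: e_def)
  then obtain y where y: "y \<in> carrier_vec m" "Q *\<^sub>v e = (Q * H) *\<^sub>v y"
    by (auto simp: leading_def)
  have Hy: "H *\<^sub>v y \<in> carrier_vec (Suc m)"
    using H(1) y(1) by simp
  have "Q *\<^sub>v (H *\<^sub>v y - e) = 0\<^sub>v (Suc m)"
    using assoc_mult_mat_vec[OF Q(2) H(1) y(1)] y(2) e(2)
    by (simp add: mult_minus_distrib_mat_vec[OF Q(2) Hy e(1)])
  then have diff: "H *\<^sub>v y - e = 0\<^sub>v (Suc m)"
    using isometric_mat_inj[OF Q] Hy e(1) by simp
  have Hye: "H *\<^sub>v y = e"
  proof (rule eq_vecI)
    fix i assume "i < dim_vec e"
    then have i: "i < Suc m"
      using e(1) by simp
    then have "(H *\<^sub>v y - e) $ i = 0"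
      using diff by simp
    then show "(H *\<^sub>v y) $ i = e $ i"
      using i e(1) Hy by simp
  qed (use e(1) H(1) in auto)
  then have "y = 0\<^sub>v m"
    unfolding e_def using hessenberg_mult_vec_eq_unit[OF H sub y(1)] by blast
  with Hye have "e $ 0 = 0"
    using H(1) by (auto simp: scalar_prod_def)
  then show False
    using a by (simp add: e_def)
qed

text \<open>In entry \<open>(i, k)\<close> of the product only indices \<open>l\<close> with
  \<open>i \<le> l \<le> k + 1\<close> contribute: none when \<open>k + 1 < i\<close>, exactly one
  when \<open>i = k + 1\<close>.\<close>

lemma triangular_times_hessenberg:
  fixes R H :: "complex mat"
  assumes R: "R \<in> carrier_mat n n" "upper_triangular R" and H: "H \<in> carrier_mat n m" "upper_hessenberg H"
  shows "upper_hessenberg (R * H)"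
    and "\<And>k. k < m \<Longrightarrow> Suc k < n \<Longrightarrow> (R * H) $$ (Suc k, k) = R $$ (Suc k, Suc k) * H $$ (Suc k, k)"
proof -
  have z: "R $$ (i, l) * H $$ (l, k) = 0" if "i < n" "l < n" "k < m" "l < i \<or> Suc k < l" for i l k
    using that R H by (auto simp: upper_hessenberg_def)
  have idx: "(R * H) $$ (i, k) = (\<Sum>l<n. R $$ (i, l) * H $$ (l, k))" if "i < n" "k < m" for i k
    using that R H by (simp add: scalar_prod_def atLeast0LessThan)
  show "upper_hessenberg (R * H)"
    unfolding upper_hessenberg_def
  proof (intro allI impI)
    fix i k assume "i < dim_row (R * H)" "k < dim_col (R * H)" and ik: "Suc k < i"
    then have "i < n" "k < m"
      using R H by auto
    moreover have "(\<Sum>l<n. R $$ (i, l) * H $$ (l, k)) = 0"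
      using z \<open>i < n\<close> \<open>k < m\<close> ik by (intro sum.neutral) (metis lessThan_iff not_less order_less_le_trans)
    ultimately show "(R * H) $$ (i, k) = 0"
      using idx by simp
  qed
  fix k assume k: "k < m" "Suc k < n"
  have "(\<Sum>l<n. R $$ (Suc k, l) * H $$ (l, k)) = (\<Sum>l\<in>{Suc k}. R $$ (Suc k, l) * H $$ (l, k))"
    using k by (intro sum.mono_neutral_right)
      (auto simp del: mult_eq_0_iff intro!: z)
  then show "(R * H) $$ (Suc k, k) = R $$ (Suc k, Suc k) * H $$ (Suc k, k)"
    using idx k by simp
qed

section \<open>Givens rotations and their products\<close>

lemma givens_rotation_carrier [simp]: "givens_rotation n j c s \<phi> \<in> carrier_mat n n"
  by (simp add: givens_rotation_def)

lemma givens_product_carrier [simp]: "givens_product n c s \<phi> j \<in> carrier_mat n n"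
  by (induction j) (auto intro!: mult_carrier_mat[of _ n n])

lemma givens_rotation_mult_vec:
  assumes z: "z \<in> carrier_vec n" and j: "Suc j < n" and k: "k < n"
  shows "(givens_rotation n j c s \<phi> *\<^sub>v z) $ k =
    (if k = j then of_real c * z $ j + of_real s * cis \<phi> * z $ Suc j
     else if k = Suc j then - of_real s * cis (- \<phi>) * z $ j + of_real c * z $ Suc j
     else z $ k)"
proof -
  let ?f = "\<lambda>l. givens_rotation n j c s \<phi> $$ (k, l) * z $ l"
  have "(givens_rotation n j c s \<phi> *\<^sub>v z) $ k = (\<Sum>l<n. ?f l)"
    using z k givens_rotation_carrier[of n j c s \<phi>] carrier_matD[OF givens_rotation_carrier[of n j c s \<phi>]]
    by (simp add: scalar_prod_def atLeast0LessThan)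
  also have "\<dots> = (\<Sum>l\<in>(if k = j \<or> k = Suc j then {j, Suc j} else {k}). ?f l)"
    using j k by (intro sum.mono_neutral_right) (auto simp: givens_rotation_def)
  also have "\<dots> = (if k = j then of_real c * z $ j + of_real s * cis \<phi> * z $ Suc j
     else if k = Suc j then - of_real s * cis (- \<phi>) * z $ j + of_real c * z $ Suc j
     else z $ k)"
    using j k by (auto simp: givens_rotation_def)
  finally show ?thesis .
qed

lemma isometric_givens_rotation:
  assumes j: "Suc j < n" and cs: "c\<^sup>2 + s\<^sup>2 = 1"
  shows "isometric_mat (givens_rotation n j c s \<phi>)"
  unfolding isometric_mat_def
proof (intro ballI)
  let ?G = "givens_rotation n j c s \<phi>"
  fix y z :: "complex vec" assume "y \<in> carrier_vec (dim_col ?G)" "z \<in> carrier_vec (dim_col ?G)"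
  then have yz: "y \<in> carrier_vec n" "z \<in> carrier_vec n"
    by (auto simp: givens_rotation_def)
  \<comment> \<open>A rotation changes only coordinates \<open>j\<close> and \<open>j + 1\<close>,
    so the claim reduces to a two-dimensional identity.\<close>
  have split: "(\<Sum>i<n. h i) = h j + h (Suc j) + (\<Sum>i\<in>{..<n} - {j, Suc j}. h i)" for h :: "nat \<Rightarrow> complex"
    using j by (subst sum.subset_diff[of "{j, Suc j}"]) auto
  have cs': "of_real c * of_real c + of_real s * of_real s = (1 :: complex)"
    using cs by (simp flip: of_real_mult of_real_add add: power2_eq_square)
  have e: "cis \<phi> * cis (- \<phi>) = 1"
    by (simp add: cis_mult)
  have "(of_real c * a + of_real s * cis \<phi> * b) * cnj (of_real c * a' + of_real s * cis \<phi> * b') +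
      (- of_real s * cis (- \<phi>) * a + of_real c * b) * cnj (- of_real s * cis (- \<phi>) * a' + of_real c * b') =
      a * cnj a' + b * cnj b'" for a a' b b' :: complex
  proof -
    \<comment> \<open>The mixed terms cancel. The product of opposite phases is kept as a factor so
      that the identity is purely polynomial; it is set to 1 afterwards.\<close>
    have "(of_real c * a + of_real s * cis \<phi> * b) * cnj (of_real c * a' + of_real s * cis \<phi> * b') +
      (- of_real s * cis (- \<phi>) * a + of_real c * b) * cnj (- of_real s * cis (- \<phi>) * a' + of_real c * b') =
      (of_real c * of_real c + of_real s * of_real s * (cis \<phi> * cis (- \<phi>))) * (a * cnj a' + b * cnj b')"
      by (simp add: cis_cnj algebra_simps)
    then show ?thesis
      by (simp only: e cs' mult_1_right mult_1_left)
  qed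
  then have "(\<Sum>i<n. (?G *\<^sub>v y) $ i * cnj ((?G *\<^sub>v z) $ i)) = (\<Sum>i<n. y $ i * cnj (z $ i))"
    unfolding split using j yz by (simp add: givens_rotation_mult_vec)
  moreover have "dim_vec (?G *\<^sub>v z) = n" "dim_row ?G = n"
    by (auto simp: givens_rotation_def)
  ultimately show "(?G *\<^sub>v y) \<bullet>c (?G *\<^sub>v z) = y \<bullet>c z"
    using yz by (simp add: scalar_prod_def atLeast0LessThan)
qed

lemma isometric_givens_product:
  assumes "\<And>i. i < j \<Longrightarrow> (c i)\<^sup>2 + (s i)\<^sup>2 = 1" "j < n"
  shows "isometric_mat (givens_product n c s \<phi> j)"
  using assms
proof (induction j)
  case 0
  then show ?case
    by (simp add: isometric_mat_def)
next
  case (Suc j)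
  then show ?case
    by (auto intro!: isometric_mat_times[of _ _ n n n] isometric_givens_rotation)
qed

text \<open>Rotations \<open>0\<close> to \<open>j - 1\<close> act only on coordinates
  \<open>0\<close> to \<open>j\<close>.\<close>

lemma givens_product_mult_vec_untouched:
  assumes "z \<in> carrier_vec n" "j < k" "k < n"
  shows "(givens_product n c s \<phi> j *\<^sub>v z) $ k = z $ k"
  using assms(2)
proof (induction j)
  case 0
  then show ?case
    using assms by simp
next
  case (Suc j)
  have "givens_product n c s \<phi> j *\<^sub>v z \<in> carrier_vec n"
    using assms(1) by (meson givens_product_carrier mult_mat_vec_carrier)
  then show ?case
    using Suc assms
    by (simp add: assoc_mult_mat_vec[of _ n n _ n] givens_rotation_mult_vec)
qed

text \<open>The last rotation turns a pair \<open>(t, 0)\<close> into \<open>(c t, - s cis (- \<phi>) t)\<close>.\<close>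

lemma givens_product_last_tails:
  fixes e :: "complex vec" and c s \<phi> :: "nat \<Rightarrow> real"
  assumes e: "e \<in> carrier_vec (Suc (Suc k))" "e $ Suc k = 0"
    and cs: "0 \<le> s k" "(c k)\<^sup>2 + (s k)\<^sup>2 = 1"
  defines "g \<equiv> givens_product (Suc (Suc k)) c s \<phi> (Suc k) *\<^sub>v e"
  shows "euclid_norm (tail_vec (Suc k) g) = s k * euclid_norm (tail_vec k g)"
proof -
  let ?n = "Suc (Suc k)"
  let ?P = "givens_product ?n c s \<phi> k"
  define t where "t = (?P *\<^sub>v e) $ k"
  have Pe: "?P *\<^sub>v e \<in> carrier_vec ?n"
    using e(1) by (meson givens_product_carrier mult_mat_vec_carrier)
  have gP: "g = givens_rotation ?n k (c k) (s k) (\<phi> k) *\<^sub>v (?P *\<^sub>v e)"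
    unfolding g_def using e(1) by (simp add: assoc_mult_mat_vec[of _ ?n ?n _ ?n])
  \<comment> \<open>The earlier rotations do not reach coordinate \<open>k + 1\<close>, where
    \<open>e\<close> is zero; hence the last one acts on \<open>(t, 0)\<close>.\<close>
  have P_last: "(?P *\<^sub>v e) $ Suc k = 0"
    using givens_product_mult_vec_untouched[OF e(1), of k "Suc k"] e(2) by simp
  have g_last: "g $ k = of_real (c k) * t" "g $ Suc k = - of_real (s k) * cis (- \<phi> k) * t"
    unfolding gP t_def using Pe P_last by (simp_all add: givens_rotation_mult_vec)
  have g: "g \<in> carrier_vec ?n"
    unfolding gP using Pe by (meson givens_rotation_carrier mult_mat_vec_carrier)
  have "(euclid_norm (tail_vec k g))\<^sup>2 = (\<Sum>i<?n. if i < k then 0 else (cmod (g $ i))\<^sup>2)"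
    using g unfolding euclid_norm_square by (intro sum.cong) auto
  also have "\<dots> = (cmod (g $ k))\<^sup>2 + (cmod (g $ Suc k))\<^sup>2"
    by simp
  also have "\<dots> = ((c k)\<^sup>2 + (s k)\<^sup>2) * (cmod t)\<^sup>2"
    unfolding g_last by (simp add: norm_mult power_mult_distrib algebra_simps)
  also have "\<dots> = (cmod t)\<^sup>2"
    using cs(2) by simp
  finally have "euclid_norm (tail_vec k g) = cmod t"
    using euclid_norm_nonneg by (simp add: power2_eq_iff_nonneg)
  moreover have "euclid_norm (tail_vec (Suc k) g) = s k * cmod t"
    unfolding euclid_norm_tail_vec_Suc[OF g] g_last using cs(1) by (simp add: norm_mult)
  ultimately show ?thesis
    by simp
qed

section \<open>Zero padding, leading columns and their spans\<close>

text \<open>Embeds the coefficient vectors for all \<open>j\<close> into one common space, where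
  they form \<open>leading j n\<close>.\<close>

definition pad_vec :: "nat \<Rightarrow> complex vec \<Rightarrow> complex vec" where
  "pad_vec n y = vec n (\<lambda>i. if i < dim_vec y then y $ i else 0)"

lemma pad_vec_carrier [simp]: "pad_vec n y \<in> carrier_vec n"
  by (simp add: pad_vec_def)

lemma pad_vec_leading: "y \<in> carrier_vec k \<Longrightarrow> pad_vec n y \<in> leading k n"
  by (auto simp: pad_vec_def leading_def)

lemma pad_vec_image:
  assumes "k \<le> n"
  shows "pad_vec n ` carrier_vec k = leading k n"
proof
  show "pad_vec n ` carrier_vec k \<subseteq> leading k n"
    using pad_vec_leading by blast
  show "leading k n \<subseteq> pad_vec n ` carrier_vec k"
  proof
    fix z assume z: "z \<in> leading k n"
    then have "z = pad_vec n (vec k (($) z))"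
      using assms by (auto simp: pad_vec_def leading_def)
    then show "z \<in> pad_vec n ` carrier_vec k"
      by auto
  qed
qed

lemma first_cols_carrier: "V \<in> carrier_mat N n \<Longrightarrow> j \<le> n \<Longrightarrow> first_cols V j \<in> carrier_mat N j"
  by (auto simp: first_cols_def)

lemma first_cols_index:
  "V \<in> carrier_mat N n \<Longrightarrow> j \<le> n \<Longrightarrow> i < N \<Longrightarrow> l < j \<Longrightarrow> first_cols V j $$ (i, l) = V $$ (i, l)"
  by (auto simp: first_cols_def mat_of_cols_def)

text \<open>The additional columns meet zero coefficients.\<close>

lemma first_cols_mult_vec:
  assumes V: "V \<in> carrier_mat N n" and jk: "j \<le> k" "k \<le> n" and y: "y \<in> carrier_vec j"
  shows "first_cols V j *\<^sub>v y = first_cols V k *\<^sub>v pad_vec k y"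
proof (rule eq_vecI)
  have car: "first_cols V j \<in> carrier_mat N j" "first_cols V k \<in> carrier_mat N k"
    using V jk first_cols_carrier by auto
  fix i assume "i < dim_vec (first_cols V k *\<^sub>v pad_vec k y)"
  then have i: "i < N"
    using car by simp
  have "(first_cols V k *\<^sub>v pad_vec k y) $ i = (\<Sum>l<k. first_cols V k $$ (i, l) * pad_vec k y $ l)"
    using car i by (simp add: scalar_prod_def atLeast0LessThan pad_vec_def)
  also have "\<dots> = (\<Sum>l<j. first_cols V k $$ (i, l) * pad_vec k y $ l)"
    using jk y by (intro sum.mono_neutral_right) (auto simp: pad_vec_def)
  also have "\<dots> = (\<Sum>l<j. first_cols V j $$ (i, l) * y $ l)"
    using jk y i first_cols_index[OF V] by (intro sum.cong) (auto simp: pad_vec_def)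
  also have "\<dots> = (first_cols V j *\<^sub>v y) $ i"
    using car i y by (simp add: scalar_prod_def atLeast0LessThan)
  finally show "(first_cols V j *\<^sub>v y) $ i = (first_cols V k *\<^sub>v pad_vec k y) $ i"
    by simp
qed (auto simp: first_cols_def)

lemma first_cols_all: "V \<in> carrier_mat N n \<Longrightarrow> first_cols V n = V"
  by (auto simp: first_cols_def)

lemma first_cols_image:
  assumes V: "V \<in> carrier_mat N n" and "j \<le> n"
  shows "(*\<^sub>v) (first_cols V j) ` carrier_vec j = (*\<^sub>v) V ` leading j n"
proof -
  have "(*\<^sub>v) (first_cols V j) ` carrier_vec j = (*\<^sub>v) V ` pad_vec n ` carrier_vec j"
    unfolding image_image using first_cols_mult_vec[OF V \<open>j \<le> n\<close> order_refl] first_cols_all[OF V]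
    by (intro image_cong) auto
  then show ?thesis
    using pad_vec_image[OF \<open>j \<le> n\<close>] by simp
qed

text \<open>A column span consists of the matrix-vector products; in this form the Krylov spaces
  become images of coordinate subspaces under \<open>V\<close>.\<close>

lemma cspan_first_cols:
  assumes V: "V \<in> carrier_mat N n" and "j \<le> n"
  shows "cspan N (set (cols (first_cols V j))) = (*\<^sub>v) V ` leading j n"
proof -
  have car: "first_cols V j \<in> carrier_mat N j"
    using first_cols_carrier assms by blast
  have "cspan N (set (cols (first_cols V j))) =
      {y \<in> carrier_vec N. \<exists>z\<in>carrier_vec j. first_cols V j *\<^sub>v z = y}"
    using vec_space.col_space_eq[OF car] unfolding vec_space.col_space_def carrier_matD[OF car] .
  also have "\<dots> = (*\<^sub>v) (first_cols V j) ` carrier_vec j"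
    using mult_mat_vec_carrier[OF car] by blast
  finally have "cspan N (set (cols (first_cols V j))) = (*\<^sub>v) (first_cols V j) ` carrier_vec j" .
  then show ?thesis
    using first_cols_image[OF assms] by simp
qed

section \<open>The Arnoldi matrix is unreduced\<close>

text \<open>A zero subdiagonal entry in column \<open>j\<close> leaves columns \<open>0\<close> to
  \<open>j\<close> with no entry below row \<open>j\<close>, so the leading coordinates
  decouple.\<close>

lemma hessenberg_mult_leading:
  fixes H :: "complex mat"
  assumes H: "H \<in> carrier_mat (Suc m) m" "upper_hessenberg H" and zero: "H $$ (Suc j, j) = 0"
    and y: "y \<in> leading (Suc j) m"
  shows "H *\<^sub>v y \<in> leading (Suc j) (Suc m)"
proof -
  have yc: "y \<in> carrier_vec m"
    using y by (simp add: leading_def)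
  have "H $$ (i, l) * y $ l = 0" if "i < Suc m" "Suc j \<le> i" "l < m" for i l
  proof (cases "l \<le> j")
    case True
    then show ?thesis
      using that H zero by (cases "l = j \<and> i = Suc j") (auto simp: upper_hessenberg_def)
  next
    case False
    then show ?thesis
      using that y by (simp add: leading_def)
  qed
  then show ?thesis
    using H(1) yc by (auto simp: leading_def scalar_prod_def intro!: sum.neutral)
qed

text \<open>If a subdiagonal entry of the Arnoldi matrix vanished, the Krylov space at that step would be
  invariant under \<open>A\<close>, so the next one could not be larger.\<close>

lemma arnoldi_subdiag_nonzero:
  fixes A V H :: "complex mat"
  assumes A: "A \<in> carrier_mat N N" and V: "V \<in> carrier_mat N (Suc m)"
    and V_inj: "\<And>y. y \<in> carrier_vec (Suc m) \<Longrightarrow> V *\<^sub>v y = 0\<^sub>v N \<Longrightarrow> y = 0\<^sub>v (Suc m)"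
    and krylov: "\<And>j. 1 \<le> j \<Longrightarrow> j \<le> Suc m \<Longrightarrow> krylov A r0 j = (*\<^sub>v) V ` leading j (Suc m)"
    and H: "H \<in> carrier_mat (Suc m) m" "upper_hessenberg H"
    and AV: "A * first_cols V m = V * H"
    and r0: "r0 \<in> carrier_vec N"
    and j: "j < m"
  shows "H $$ (Suc j, j) \<noteq> 0"
proof
  assume zero: "H $$ (Suc j, j) = 0"
  let ?E = "(*\<^sub>v) V ` leading (Suc j) (Suc m)"
  have lead: "y \<in> carrier_vec n" if "y \<in> leading k n" for y k n
    using that by (simp add: leading_def)
  have E: "?E = cspan N (set (cols (first_cols V (Suc j))))"
    using cspan_first_cols[OF V, of "Suc j"] j by simp
  have E_cols: "set (cols (first_cols V (Suc j))) \<subseteq> carrier_vec N"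
    using first_cols_carrier[OF V, of "Suc j"] j cols_dim by fastforce
  \<comment> \<open>Since \<open>j < m\<close>, the coefficients of \<open>v\<close> fit into the
    first \<open>m\<close> columns of \<open>V\<close>, where the Arnoldi relation \<open>AV\<close>
    is available.\<close>
  have inv: "A *\<^sub>v v \<in> ?E" if v: "v \<in> ?E" for v
  proof -
    obtain y' where y': "y' \<in> leading (Suc j) (Suc m)" "v = V *\<^sub>v y'"
      using v by blast
    then obtain y where y: "y \<in> carrier_vec (Suc j)" "y' = pad_vec (Suc m) y"
      using pad_vec_image[of "Suc j" "Suc m"] j by auto
    have "v = first_cols V (Suc j) *\<^sub>v y"
      using first_cols_mult_vec[OF V _ order_refl y(1)] j y'(2) y(2) first_cols_all[OF V] by simp
    also have "\<dots> = first_cols V m *\<^sub>v pad_vec m y"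
      using first_cols_mult_vec[OF V _ _ y(1), of m] j by simp
    finally have "A *\<^sub>v v = (A * first_cols V m) *\<^sub>v pad_vec m y"
      using assoc_mult_mat_vec[OF A first_cols_carrier[OF V]] by simp
    also have "\<dots> = V *\<^sub>v (H *\<^sub>v pad_vec m y)"
      unfolding AV using assoc_mult_mat_vec[OF V H(1)] by simp
    finally show ?thesis
      using hessenberg_mult_leading[OF H zero pad_vec_leading[OF y(1)]] by auto
  qed
  have "r0 \<in> krylov A r0 1"
  proof -
    have "(A ^\<^sub>m 0) *\<^sub>v r0 = r0"
      using A r0 by simp
    then have "krylov A r0 1 = cspan N {r0}"
      using r0 by (simp add: krylov_def carrier_vecD lessThan_Suc)
    then show ?thesis
      using vectorspace.span_mem[OF vec_vs, of "{r0}" N r0] r0 by (simp add: module_vec_def)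
  qed
  then have "r0 \<in> (*\<^sub>v) V ` leading 1 (Suc m)"
    using krylov[of 1] by simp
  then have r0E: "r0 \<in> ?E"
    by (auto simp: leading_def)
  have pow: "(A ^\<^sub>m i) *\<^sub>v r0 \<in> ?E" for i
  proof (induction i)
    case 0
    then show ?case
      using r0E A r0 by simp
  next
    case (Suc i)
    \<comment> \<open>Matrix powers append the new factor on the right, whereas the invariance of
      \<open>?E\<close> needs it on the left.\<close>
    have comm: "A ^\<^sub>m Suc i = A * A ^\<^sub>m i"
      by (induction i) (use A in \<open>simp_all add: assoc_mult_mat[of _ N N _ N _ N] pow_carrier_mat\<close>)
    have "(A ^\<^sub>m Suc i) *\<^sub>v r0 = A *\<^sub>v ((A ^\<^sub>m i) *\<^sub>v r0)"
      unfolding comm using assoc_mult_mat_vec[OF A pow_carrier_mat[OF A] r0] .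
    then show ?case
      using inv[OF Suc.IH] by simp
  qed
  have "krylov A r0 (Suc (Suc j)) \<subseteq> ?E"
  proof -
    have "(\<lambda>i. (A ^\<^sub>m i) *\<^sub>v r0) ` {..<Suc (Suc j)} \<subseteq> cspan N (set (cols (first_cols V (Suc j))))"
      using pow unfolding E by blast
    then show ?thesis
      unfolding krylov_def E using r0 idom_vec.span_subsetI[OF E_cols] by (simp add: carrier_vecD)
  qed
  moreover have u: "unit_vec (Suc m) (Suc j) \<in> leading (Suc (Suc j)) (Suc m)"
    by (auto simp: leading_def)
  \<comment> \<open>Column \<open>j + 1\<close> of \<open>V\<close> thus lies in the span of the
    columns before it, which contradicts injectivity.\<close>
  ultimately have "V *\<^sub>v unit_vec (Suc m) (Suc j) \<in> ?E"
    using krylov[of "Suc (Suc j)"] j by auto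
  then obtain y where y: "y \<in> leading (Suc j) (Suc m)" "V *\<^sub>v unit_vec (Suc m) (Suc j) = V *\<^sub>v y"
    by blast
  have "V *\<^sub>v (unit_vec (Suc m) (Suc j) - y) = 0\<^sub>v N"
    using y(2) lead[OF y(1)] V by (subst mult_minus_distrib_mat_vec[OF V]) auto
  then have "unit_vec (Suc m) (Suc j) - y = 0\<^sub>v (Suc m)"
    using V_inj lead[OF y(1)] by simp
  then have "(unit_vec (Suc m) (Suc j) - y) $ Suc j = 0"
    using j by simp
  then show False
    using y(1) j lead[OF y(1)] by (simp add: leading_def)
qed

section \<open>Sketched GMRES as a triangular least-squares problem\<close>

text \<open>In the coordinates given by \<open>U\<close> the GMRES objective is the norm of
  \<open>g - T y\<close> with \<open>y\<close> padded, and these fits range over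
  \<open>leading j n\<close>. Hence \<open>least_squares_residual\<close> applies.\<close>

lemma sketched_gmres_residual:
  assumes car: "A \<in> carrier_mat N N" "b \<in> carrier_vec N" "x0 \<in> carrier_vec N" "S \<in> carrier_mat d N"
      "first_cols V j \<in> carrier_mat N j" "T \<in> carrier_mat n m"
    and U: "isometric_mat U" "U \<in> carrier_mat d n" and g: "g \<in> carrier_vec n"
    and init: "S *\<^sub>v (b - A *\<^sub>v x0) = U *\<^sub>v g"
    and sketch: "\<And>y. y \<in> carrier_vec j \<Longrightarrow>
      S *\<^sub>v (A *\<^sub>v (first_cols V j *\<^sub>v y)) = U *\<^sub>v (T *\<^sub>v pad_vec m y)"
    and img: "(\<lambda>y. T *\<^sub>v pad_vec m y) ` carrier_vec j = leading j n"
    and x: "sketched_gmres_iterate S A b x0 V j x"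
  shows "S *\<^sub>v (b - A *\<^sub>v x) = U *\<^sub>v tail_vec j g"
proof -
  obtain y where
    y: "is_arg_min (\<lambda>y. euclid_norm (S *\<^sub>v ((b - A *\<^sub>v x0) - A *\<^sub>v (first_cols V j *\<^sub>v y))))
          (\<lambda>y. y \<in> carrier_vec j) y"
    and xj: "x = x0 + first_cols V j *\<^sub>v y"
    using x unfolding sketched_gmres_iterate_def by blast
  have yj: "y \<in> carrier_vec j"
    using y by (simp add: is_arg_min_def)
  have r0: "b - A *\<^sub>v x0 \<in> carrier_vec N"
    using car by simp
  have step: "S *\<^sub>v ((b - A *\<^sub>v x0) - A *\<^sub>v (first_cols V j *\<^sub>v z)) = U *\<^sub>v (g - T *\<^sub>v pad_vec m z)"
    if z: "z \<in> carrier_vec j" for z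
  proof -
    have "A *\<^sub>v (first_cols V j *\<^sub>v z) \<in> carrier_vec N"
      using car z by (meson mult_mat_vec_carrier)
    then show ?thesis
      using mult_minus_distrib_mat_vec[OF car(4) r0] mult_minus_distrib_mat_vec[OF U(2) g]
        sketch[OF z] init car(6) by simp
  qed
  \<comment> \<open>The two objectives agree only on \<open>carrier_vec j\<close>, which is where
    the minimization takes place.\<close>
  have "is_arg_min (\<lambda>y. euclid_norm (U *\<^sub>v (g - T *\<^sub>v pad_vec m y))) (\<lambda>y. y \<in> carrier_vec j) y"
    using y by (auto simp: is_arg_min_def step)
  then have "g - T *\<^sub>v pad_vec m y = tail_vec j g"
    using least_squares_residual[OF U g, where f = "\<lambda>y. T *\<^sub>v pad_vec m y"
        and P = "\<lambda>y. y \<in> carrier_vec j" and k = j and y = y] img by simp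
  moreover have "b - A *\<^sub>v x = (b - A *\<^sub>v x0) - A *\<^sub>v (first_cols V j *\<^sub>v y)"
  proof -
    have "first_cols V j *\<^sub>v y \<in> carrier_vec N"
      using car yj by simp
    then show ?thesis
      unfolding xj using car
      by (auto simp: mult_add_distrib_mat_vec[OF car(1)] intro!: eq_vecI)
  qed
  ultimately show ?thesis
    using step[OF yj] by simp
qed

section \<open>Sketched angles and residual norms\<close>

theorem theorem4p6:
  fixes A S V H W R Hhat Q Rhat :: "complex mat"
    and b x0 r0 :: "complex vec"
    and x r :: "nat \<Rightarrow> complex vec"
    and c s \<phi> :: "nat \<Rightarrow> real"
    and N m d :: nat
  assumes A: "A \<in> carrier_mat N N"
    and b: "b \<in> carrier_vec N"
    and x0: "x0 \<in> carrier_vec N"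
    and r0: "r0 = b - A *\<^sub>v x0" "r0 \<noteq> 0\<^sub>v N"
    and m: "1 \<le> m"
    and V: "V \<in> carrier_mat N (m + 1)" "lin_indep_cols V"
    and V_first: "col V 0 = complex_of_real (1 / euclid_norm r0) \<cdot>\<^sub>v r0"
    and V_basis: "\<And>j. 1 \<le> j \<Longrightarrow> j \<le> m + 1 \<Longrightarrow> cols_basis_of (first_cols V j) (krylov A r0 j)"
    and H: "H \<in> carrier_mat (m + 1) m" "upper_hessenberg H"
    and AV: "A * first_cols V m = V * H"
    and S: "S \<in> carrier_mat d N"
    and SV_rank: "vec_space.rank d (S * V) = m + 1"
    and QR: "economy_qr (S * V) W R"
    and Hhat: "Hhat = R * H"
    and givens: "givens_reduction Hhat m c s \<phi>"
    and Q: "Q = givens_product (m + 1) c s \<phi> m"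
    and Rhat: "Rhat = Q * Hhat" "upper_triangular Rhat"
    and x: "\<And>j. j \<le> m \<Longrightarrow> sketched_gmres_iterate S A b x0 V j (x j)"
    and r: "\<And>j. j \<le> m \<Longrightarrow> r j = b - A *\<^sub>v x j"
  shows "sin (angle_to_subspace (S *\<^sub>v r0) ((\<lambda>v. S *\<^sub>v (A *\<^sub>v v)) ` krylov A r0 m))
           = cmod (Q $$ (m, 0))
       \<and> sin (angle_to_subspace (S *\<^sub>v r (m - 1)) ((\<lambda>v. S *\<^sub>v (A *\<^sub>v v)) ` krylov A r0 m))
           = s (m - 1)
       \<and> euclid_norm (S *\<^sub>v r m) = \<bar>s (m - 1)\<bar> * euclid_norm (S *\<^sub>v r (m - 1))"
proof -
  define n where "n = Suc m"
  have mn: "m + 1 = n" "Suc (m - 1) = m" "m \<le> n" "m < n" "0 < n" "m - 1 < n" "m - 1 \<le> m"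
    using m by (auto simp: n_def)
  note V = V[unfolded mn] and H = H[unfolded mn]
  have r0N: "r0 \<in> carrier_vec N"
    using A b x0 r0(1) by simp
  have SV: "S * V \<in> carrier_mat d n"
    using S V(1) by simp
  have WR: "W \<in> carrier_mat d n" "R \<in> carrier_mat n n" "S * V = W * R" "upper_triangular R"
    and W_iso: "isometric_mat W" and R_diag: "\<And>i. i < n \<Longrightarrow> R $$ (i, i) \<noteq> 0"
    using QR[unfolded economy_qr_def carrier_matD[OF SV]] isometric_mat_adjointI[of W d n] by force+
  note R_inj = triangular_mat_inj[OF WR(2,4) R_diag]
  have SVy: "S *\<^sub>v (V *\<^sub>v y) = W *\<^sub>v (R *\<^sub>v y)" if "y \<in> carrier_vec n" for y
    using assoc_mult_mat_vec[OF S V(1) that] assoc_mult_mat_vec[OF WR(1,2) that] WR(3) by simp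
  \<comment> \<open>Injectivity of \<open>V\<close> is inherited from \<open>S * V = W * R\<close>,
    with \<open>W\<close> isometric and \<open>R\<close> invertible.\<close>
  have V_inj: "y = 0\<^sub>v n" if y: "y \<in> carrier_vec n" "V *\<^sub>v y = 0\<^sub>v N" for y
  proof -
    have "S *\<^sub>v 0\<^sub>v N = 0\<^sub>v d"
      using S by (intro eq_vecI) auto
    then have "W *\<^sub>v (R *\<^sub>v y) = 0\<^sub>v d"
      using SVy[OF y(1)] y(2) by simp
    then show ?thesis
      using isometric_mat_inj[OF W_iso WR(1)] R_inj WR(2) y(1) by simp
  qed
  have kry: "krylov A r0 j = (*\<^sub>v) V ` leading j n" if "1 \<le> j" "j \<le> n" for j
    using V_basis[OF that(1)] that cspan_first_cols[OF V(1) that(2)] first_cols_carrier[OF V(1) that(2)]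
    by (simp add: n_def cols_basis_of_def)
  have H_sub: "H $$ (Suc j, j) \<noteq> 0" if "j < m" for j
    using arnoldi_subdiag_nonzero[OF A _ _ _ _ H(2) AV r0N that] V_inj kry V(1) H(1)
    unfolding n_def by blast
  have Hh: "Hhat \<in> carrier_mat n m" "upper_hessenberg Hhat"
    using triangular_times_hessenberg(1)[OF WR(2,4) H] WR(2) H(1) by (auto simp: Hhat)
  \<comment> \<open>Each subdiagonal entry is a nonzero diagonal entry of \<open>R\<close> times a
    nonzero subdiagonal entry of \<open>H\<close>.\<close>
  have Hh_sub: "Hhat $$ (Suc k, k) \<noteq> 0" if "k < m" for k
    using triangular_times_hessenberg(2)[OF WR(2,4) H that] H_sub[OF that] R_diag[of "Suc k"] that
    by (simp add: Hhat n_def)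

  have cs: "0 \<le> c j" "0 \<le> s j" "(c j)\<^sup>2 + (s j)\<^sup>2 = 1" if "j < m" for j
    using givens that by (auto simp: givens_reduction_def)
  have Q: "Q = givens_product n c s \<phi> m"
    using Q mn by simp
  have Qc: "Q \<in> carrier_mat n n"
    by (simp add: Q)
  have Q_iso: "isometric_mat Q"
    unfolding Q using cs mn by (intro isometric_givens_product) auto
  \<comment> \<open>As \<open>Q\<close> is unitary, \<open>Q'\<close> is its adjoint; with
    \<open>U = W * Q'\<close> one gets \<open>U * Q = W\<close>.\<close>
  obtain Q' where Q': "Q' \<in> carrier_mat n n" "Q' * Q = 1\<^sub>m n" "isometric_mat Q'"
    using isometric_mat_inverse[OF Q_iso Qc] .
  define U where "U = W * Q'"
  have U: "isometric_mat U" "U \<in> carrier_mat d n"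
    using isometric_mat_times[OF W_iso Q'(3) WR(1) Q'(1)] WR(1) Q'(1) by (auto simp: U_def)
  have UQ: "U *\<^sub>v (Q *\<^sub>v z) = W *\<^sub>v z" if "z \<in> carrier_vec n" for z
  proof -
    have "U *\<^sub>v (Q *\<^sub>v z) = W *\<^sub>v (Q' *\<^sub>v (Q *\<^sub>v z))"
      unfolding U_def using assoc_mult_mat_vec[OF WR(1) Q'(1)] Qc that by simp
    also have "Q' *\<^sub>v (Q *\<^sub>v z) = z"
      using assoc_mult_mat_vec[OF Q'(1) Qc that] Q'(2) that by simp
    finally show ?thesis .
  qed
  have Rh: "Rhat \<in> carrier_mat n m"
    using Qc Hh(1) by (simp add: Rhat(1))
  have Rhy: "Rhat *\<^sub>v y = Q *\<^sub>v (Hhat *\<^sub>v y)" if "y \<in> carrier_vec m" for y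
    unfolding Rhat(1) by (rule assoc_mult_mat_vec[OF Qc Hh(1) that])
  note reduced = Q_iso Qc[unfolded n_def] Hh[unfolded n_def] Hh_sub Rhat(2)[unfolded Rhat(1)]
  have Rh_img: "(*\<^sub>v) Rhat ` leading k m = leading k n" if "k \<le> m" for k
    using hessenberg_triangular_image[OF reduced that] by (simp add: Rhat(1) n_def)

  \<comment> \<open>The chain is \<open>A V y = V (H y)\<close>, then \<open>S V = W R\<close>, then
    \<open>R H = Hhat\<close>, and finally \<open>W = U Q\<close> with
    \<open>Q Hhat = Rhat\<close>.\<close>
  have sketch: "S *\<^sub>v (A *\<^sub>v (first_cols V j *\<^sub>v y)) = U *\<^sub>v (Rhat *\<^sub>v pad_vec m y)"
    if "j \<le> m" "y \<in> carrier_vec j" for j y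
  proof -
    have "A *\<^sub>v (first_cols V j *\<^sub>v y) = (A * first_cols V m) *\<^sub>v pad_vec m y"
      using first_cols_mult_vec[OF V(1) that(1) mn(3) that(2)]
        assoc_mult_mat_vec[OF A first_cols_carrier[OF V(1) mn(3)]] by simp
    also have "\<dots> = V *\<^sub>v (H *\<^sub>v pad_vec m y)"
      unfolding AV using assoc_mult_mat_vec[OF V(1) H(1)] by simp
    also have "S *\<^sub>v \<dots> = W *\<^sub>v (R *\<^sub>v (H *\<^sub>v pad_vec m y))"
      using SVy H(1) by simp
    also have "R *\<^sub>v (H *\<^sub>v pad_vec m y) = Hhat *\<^sub>v pad_vec m y"
      unfolding Hhat using assoc_mult_mat_vec[OF WR(2) H(1)] by simp
    also have "W *\<^sub>v (Hhat *\<^sub>v pad_vec m y) = U *\<^sub>v (Rhat *\<^sub>v pad_vec m y)"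
      using UQ Rhy Hh(1) by simp
    finally show ?thesis .
  qed
  have fit_img: "(\<lambda>y. Rhat *\<^sub>v pad_vec m y) ` carrier_vec j = leading j n" if "j \<le> m" for j
    using pad_vec_image[OF that] Rh_img[OF that] by (metis image_image)
  have "krylov A r0 m = (*\<^sub>v) (first_cols V m) ` carrier_vec m"
    using kry[OF m mn(3)] first_cols_image[OF V(1) mn(3)] by simp
  then have "(\<lambda>v. S *\<^sub>v (A *\<^sub>v v)) ` krylov A r0 m =
      (\<lambda>y. U *\<^sub>v (Rhat *\<^sub>v pad_vec m y)) ` carrier_vec m"
    by (simp add: image_image sketch)
  also have "\<dots> = (*\<^sub>v) U ` leading m n"
    unfolding fit_img[OF order_refl, symmetric] image_image ..
  finally have space: "(\<lambda>v. S *\<^sub>v (A *\<^sub>v v)) ` krylov A r0 m = (*\<^sub>v) U ` leading m n" .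

  \<comment> \<open>Since \<open>r0\<close> is its norm times the first column of \<open>V\<close>,
    and the first column of the triangular \<open>R\<close> has only its top entry,
    \<open>\<kappa>\<close> is the coefficient of \<open>S r0\<close> on the first column of
    \<open>W\<close>.\<close>
  define \<kappa> where "\<kappa> = R $$ (0, 0) * of_real (euclid_norm r0)"
  have \<beta>: "euclid_norm r0 \<noteq> 0"
    using euclid_norm_eq_0_iff[OF r0N] r0(2) by simp
  have \<kappa>: "\<kappa> \<noteq> 0"
    using R_diag[OF mn(5)] \<beta> by (simp add: \<kappa>_def)
  define e where "e = \<kappa> \<cdot>\<^sub>v unit_vec n 0"
  have e: "e \<in> carrier_vec n"
    by (simp add: e_def)
  define g where "g = Q *\<^sub>v e"
  have g: "g \<in> carrier_vec n"
    using Qc e by (simp add: g_def)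
  have Sr0: "S *\<^sub>v r0 = U *\<^sub>v g"
  proof -
    let ?b = "complex_of_real (euclid_norm r0) \<cdot>\<^sub>v unit_vec n 0"
    have "V *\<^sub>v ?b = complex_of_real (euclid_norm r0) \<cdot>\<^sub>v col V 0"
      using V(1) mn(5) by (intro eq_vecI) auto
    also have "\<dots> = r0"
      unfolding V_first using \<beta> by (simp add: smult_smult_assoc)
    finally have "S *\<^sub>v r0 = W *\<^sub>v (R *\<^sub>v ?b)"
      using SVy[of ?b] by simp
    also have "R *\<^sub>v ?b = e"
      using WR(2) mn(5) upper_triangularD[OF WR(4)] by (intro eq_vecI) (auto simp: e_def \<kappa>_def)
    finally show ?thesis
      using UQ[OF e] by (simp add: g_def)
  qed
  \<comment> \<open>When \<open>m = 1\<close> the case \<open>j = 0\<close> is used too; there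
    nothing is deleted.\<close>
  have residual: "S *\<^sub>v r j = U *\<^sub>v tail_vec j g" if j: "j \<le> m" for j
    unfolding r[OF j]
    using j mn(3) first_cols_carrier[OF V(1), of j] sketch[OF j] fit_img[OF j] x[OF j] Sr0 r0(1)
    by (intro sketched_gmres_residual[OF A b x0 S _ Rh U g]) auto
  \<comment> \<open>The last of the \<open>m\<close> rotations has index \<open>m - 1\<close>, and
    \<open>e\<close> is zero at coordinate \<open>m\<close> because
    \<open>m \<ge> 1\<close>.\<close>
  have norm_tails: "euclid_norm (tail_vec m g) = s (m - 1) * euclid_norm (tail_vec (m - 1) g)"
    using givens_product_last_tails[of e "m - 1" s c \<phi>] e cs[of "m - 1"] m mn
    unfolding g_def Q e_def n_def by simp
  have "tail_vec m g \<noteq> 0\<^sub>v n"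
    using hessenberg_tail_nonzero[OF reduced \<kappa>] by (simp add: g_def e_def n_def)
  \<comment> \<open>By \<open>norm_tails\<close>, a zero norm here would make
    \<open>tail_vec m g\<close> zero as well. This norm is the denominator of the second
    sine.\<close>
  then have tail_nonzero: "euclid_norm (tail_vec (m - 1) g) \<noteq> 0"
    using euclid_norm_eq_0_iff[of "tail_vec m g" n] g norm_tails by auto
  have norm_g: "euclid_norm g = cmod \<kappa>"
  proof -
    have "(euclid_norm e)\<^sup>2 = (\<Sum>i\<in>{0}. (cmod (e $ i))\<^sup>2)"
      unfolding euclid_norm_square using mn(5)
      by (intro sum.mono_neutral_right) (auto simp: e_def)
    then show ?thesis
      using euclid_norm_isometric[OF Q_iso Qc e] euclid_norm_nonneg mn(5)
      by (simp add: g_def e_def power2_eq_iff_nonneg)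
  qed
  have "g $ m = \<kappa> * Q $$ (m, 0)"
    using Qc mn by (simp add: g_def e_def)
  \<comment> \<open>The sine is the modulus of the last coordinate of \<open>g\<close> over the norm
    of \<open>g\<close>, and the factor \<open>cmod \<kappa>\<close> cancels.\<close>
  then have "sin (angle_to_subspace (S *\<^sub>v r0) ((*\<^sub>v) U ` leading m n)) = cmod (Q $$ (m, 0))"
    unfolding Sr0 using sin_angle_leading_image[OF U g, of m] norm_g \<kappa> g
    by (simp add: euclid_norm_tail_vec_Suc n_def norm_mult)
  \<comment> \<open>Deleting \<open>m\<close> coordinates from a vector that has already lost
    \<open>m - 1\<close> gives \<open>tail_vec m g\<close>, so the sine is the ratio in
    \<open>norm_tails\<close>.\<close>
  moreover have "sin (angle_to_subspace (S *\<^sub>v r (m - 1)) ((*\<^sub>v) U ` leading m n)) = s (m - 1)"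
    unfolding residual[OF mn(7)] sin_angle_leading_image[OF U tail_vec_carrier[OF g]]
      tail_vec_tail_vec[OF mn(7)] norm_tails using tail_nonzero by (rule nonzero_mult_div_cancel_right)
  moreover have "euclid_norm (S *\<^sub>v r m) = \<bar>s (m - 1)\<bar> * euclid_norm (S *\<^sub>v r (m - 1))"
    unfolding residual[OF mn(7)] residual[OF order_refl] euclid_norm_isometric[OF U tail_vec_carrier[OF g]]
      norm_tails using cs(2)[of "m - 1"] m by simp
  ultimately show ?thesis
    unfolding space by blast
qed

end
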